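(* Let $n \ge 1$ and let $\mathcal{A}$ be a non-degenerate deformation of the type $A_{n-1}$ Coxeter arrangement in $\mathbb{R}^n$, i.e. \[\mathcal{A} = \{x_i-x_j = a_{ij}^{(1)},\ldots,a_{ij}^{(t_{ij})}\ |\ 1\le i \ne j \le n\},\] where $a_{ij}^{(1)},\ldots,a_{ij}^{(t_{ij})} \in \mathbb{R}$ and $t_{ij} \ge 1$ for all $1 \le i \ne j \le n$. Then \[\chi_{\mathcal{A}}(t) = \sum_{k = 0}^{n} (-1)^{n-k} \cdot r_k(\mathcal{A}) \cdot \binom{t}{k},\] where $r_k(\mathcal{A})$ is the number of regions of $\mathcal{A}$ of level $k$.
   Context: A hyperplane arrangement is a finite set of affine hyperplanes in $\mathbb{R}^n$. Its intersection poset $L(\mathcal{A})$ is the set of all nonempty intersections of hyperplanes of $\mathcal{A}$ (including $\mathbb{R}^n$ itself, the empty intersection), ordered by reverse inclusion. The characteristic polynomial is $\chi_{\mathcal{A}}(t) = \sum_{x \in L(\mathcal{A})} \mu(\hat{0},x)\, t^{\dim x}$, where $\mu$ is the Möbius function of $L(\mathcal{A})$ and $\hat 0 = \mathbb{R}^n$. "Non-degenerate" means that for every pair $i \ne j$ there is at least one hyperplane of the form $x_i - x_j = c$ in $\mathcal{A}$ (note $x_i-x_j=c$ and $x_j-x_i=-c$ are the same hyperplane). A region of $\mathcal{A}$ is a connected component of $\mathbb{R}^n \setminus \bigcup_{H\in\mathcal{A}} H$. The level of a subset $X \subset \mathbb{R}^n$ is the smallest non-negative integer $\ell$ such that $X \subset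 \{x \in \mathbb{R}^n : d(x,W) \le r\}$ for some linear subspace $W$ of dimension $\ell$ and some real $r>0$. Here $\binom{t}{k} = t(t-1)\cdots(t-k+1)/k!$ as a polynomial in $t$. *)

theory Defs
  imports "HOL-Analysis.Analysis"
begin

definition hyp :: "'n::finite \<Rightarrow> 'n \<Rightarrow> real \<Rightarrow> (real^'n) set" where
  "hyp i j c = {x. x$i - x$j = c}"

definition intersection_poset :: "'a set set \<Rightarrow> 'a set set" where
  "intersection_poset A = {X. \<exists>B\<subseteq>A. X = \<Inter>B \<and> X \<noteq> {}}"

definition mobius :: "'a set \<Rightarrow> ('a \<Rightarrow> 'a \<Rightarrow> bool) \<Rightarrow> 'a \<Rightarrow> 'a \<Rightarrow> real" where
  "mobius P le x = (THE m. \<forall>y. m y =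
     (if y \<in> P \<and> le x y then
        (if y = x then 1 else - (\<Sum>z\<in>{z\<in>P. le x z \<and> le z y \<and> z \<noteq> y}. m z))
      else 0))"

definition char_poly :: "(real^'n::finite) set set \<Rightarrow> real \<Rightarrow> real" where
  "char_poly A t = (\<Sum>X\<in>intersection_poset A.
      mobius (intersection_poset A) (\<lambda>X Y. Y \<subseteq> X) UNIV X * t ^ nat (aff_dim X))"

definition regions :: "(real^'n::finite) set set \<Rightarrow> (real^'n) set set" where
  "regions A = components (UNIV - \<Union>A)"

definition level :: "(real^'n::finite) set \<Rightarrow> nat" where
  "level X = (LEAST l. \<exists>W r. subspace W \<and> dim W = l \<and> r > 0 \<and>
                         X \<subseteq> {x. infdist x W \<le> r})"

definition num_regions_level :: "(real^'n::finite) set set \<Rightarrow> nat \<Rightarrow> nat" where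
  "num_regions_level A k = card {R \<in> regions A. level R = k}"

end

theory Submission
  imports Defs
begin

text \<open>
  Evaluate at a negative integer \<open>-t\<close>. By Whitney's theorem the characteristic polynomial is a signed
  sum of \<open>(-t)^dim\<close> over central subarrangements \<open>B\<close>, and \<open>t^dim\<close> counts the integer vectors
  \<open>f\<close> in \<open>[0,t)^n\<close> parallel to the flat of \<open>B\<close>. Exchanging the sums, Zaslavsky's theorem turns the
  inner sum into the number of regions of the subarrangement of hyperplanes parallel to \<open>f\<close>. Moving
  far in direction \<open>f\<close> identifies these with the regions of \<open>A\<close> that have \<open>f\<close> in their recession cone.
  So \<open>(-1)^n \<chi>(-t)\<close> counts pairs of a region and an integer vector of the box in its recession cone.
  By non-degeneracy that cone consists of the vectors monotone for a total preorder on the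
  coordinates; its number \<open>k\<close> of classes is the level of the region, and it contains
  \<open>(t + k - 1) choose k = (-1)^k (-t gchoose k)\<close> vectors of the box.
\<close>

section \<open>Zaslavsky's theorem\<close>

text \<open>Hyperplanes are indexed families, so that they may coincide or become empty or everything
  when intersected with an affine set in the deletion-restriction induction.\<close>

definition complement :: "('i \<Rightarrow> 'e::euclidean_space) \<Rightarrow> ('i \<Rightarrow> real) \<Rightarrow> 'i set \<Rightarrow> 'e set" where
  "complement a b I = {x. \<forall>i\<in>I. a i \<bullet> x \<noteq> b i}"

text \<open>Off the hyperplanes this set records the whole sign vector: an index of \<open>I\<close>
  outside it stands for the strict inequality \<open>a i \<bullet> x < b i\<close>.\<close>

definition positive_side :: "('i \<Rightarrow> 'e::euclidean_space) \<Rightarrow> ('i \<Rightarrow> real) \<Rightarrow> 'i set \<Rightarrow> 'e \<Rightarrow> 'i set" where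
  "positive_side a b I x = {i\<in>I. a i \<bullet> x > b i}"

text \<open>For affine \<open>V\<close> the points with a common sign vector form a convex set, so
  these sign vectors stand for the regions that the arrangement induces on \<open>V\<close>.\<close>

definition patterns :: "('i \<Rightarrow> 'e::euclidean_space) \<Rightarrow> ('i \<Rightarrow> real) \<Rightarrow> 'i set \<Rightarrow> 'e set \<Rightarrow> 'i set set" where
  "patterns a b I V = positive_side a b I ` (V \<inter> complement a b I)"

definition flat :: "('i \<Rightarrow> 'e::euclidean_space) \<Rightarrow> ('i \<Rightarrow> real) \<Rightarrow> 'i set \<Rightarrow> 'e set" where
  "flat a b I = {x. \<forall>i\<in>I. a i \<bullet> x = b i}"

text \<open>The value 0 at the empty set cancels the non-central subfamilies, so that alternating
  sums can range over a full power set.\<close>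

definition dim_sign :: "'e::euclidean_space set \<Rightarrow> real" where
  "dim_sign V = (if V = {} then 0 else (- 1) ^ nat (aff_dim V))"

lemma finite_patterns: "finite I \<Longrightarrow> finite (patterns a b I V)"
  by (rule finite_subset[of _ "Pow I"]) (auto simp: patterns_def positive_side_def)

text \<open>Finitely many strict inequalities hold at \<open>s = 0\<close>, and each is continuous
  in \<open>s\<close>. This is what allows a point lying on one further hyperplane to be pushed off
  it to either side.\<close>

lemma perturbation_keeps_side:
  assumes "finite I" "x \<in> complement a b I"
  shows "\<exists>e>0. \<forall>s. \<bar>s\<bar> < e \<longrightarrow> x + s *\<^sub>R v \<in> complement a b I
           \<and> positive_side a b I (x + s *\<^sub>R v) = positive_side a b I x"
proof -
  have "\<forall>\<^sub>F s in nhds (0::real). \<forall>i\<in>I. (a i \<bullet> x < b i \<longrightarrow> a i \<bullet> (x + s *\<^sub>R v) < b i) \<and>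
      (b i < a i \<bullet> x \<longrightarrow> b i < a i \<bullet> (x + s *\<^sub>R v))"
  proof (intro eventually_ball_finite assms(1) ballI)
    fix i
    have "((\<lambda>s. a i \<bullet> (x + s *\<^sub>R v)) \<longlongrightarrow> a i \<bullet> (x + 0 *\<^sub>R v)) (nhds (0::real))"
      by (intro tendsto_intros filterlim_ident)
    then have lim: "((\<lambda>s. a i \<bullet> (x + s *\<^sub>R v)) \<longlongrightarrow> a i \<bullet> x) (nhds (0::real))" by simp
    show "\<forall>\<^sub>F s in nhds (0::real). (a i \<bullet> x < b i \<longrightarrow> a i \<bullet> (x + s *\<^sub>R v) < b i) \<and>
      (b i < a i \<bullet> x \<longrightarrow> b i < a i \<bullet> (x + s *\<^sub>R v))"
      using order_tendstoD[OF lim] by (auto intro!: eventually_conj eventually_mono[OF always_eventually]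
          simp: eventually_conj_iff)
  qed
  then obtain e where e: "e > 0" "\<And>s i. \<lbrakk>\<bar>s\<bar> < e; i \<in> I\<rbrakk> \<Longrightarrow> (a i \<bullet> x < b i \<longrightarrow> a i \<bullet> (x + s *\<^sub>R v) < b i) \<and>
      (b i < a i \<bullet> x \<longrightarrow> b i < a i \<bullet> (x + s *\<^sub>R v))"
    unfolding eventually_nhds_metric by (auto simp: dist_norm)
  show ?thesis
  proof (intro exI[of _ e] conjI allI impI e(1))
    fix s :: real assume s: "\<bar>s\<bar> < e"
    have *: "i \<in> I \<Longrightarrow> a i \<bullet> x < b i \<or> b i < a i \<bullet> x" for i
      using assms(2) by (force simp: complement_def)
    show "x + s *\<^sub>R v \<in> complement a b I"
      unfolding complement_def using e(2)[OF s] * by fastforce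
    show "positive_side a b I (x + s *\<^sub>R v) = positive_side a b I x"
      unfolding positive_side_def using e(2)[OF s] * by fastforce
  qed
qed

lemma same_side_convex:
  assumes "x \<in> complement a b I" "y \<in> complement a b I"
    and "positive_side a b I x = positive_side a b I y" "0 \<le> u" "u \<le> 1"
  defines "z \<equiv> (1 - u) *\<^sub>R x + u *\<^sub>R y"
  shows "z \<in> complement a b I" "positive_side a b I z = positive_side a b I x"
proof -
  have *: "(a i \<bullet> z > b i \<longleftrightarrow> a i \<bullet> x > b i) \<and> a i \<bullet> z \<noteq> b i" if "i \<in> I" for i
  proof -
    have x: "a i \<bullet> x \<noteq> b i" "a i \<bullet> y \<noteq> b i" and iff: "a i \<bullet> x > b i \<longleftrightarrow> a i \<bullet> y > b i"
      using assms(1-3) that by (auto simp: complement_def positive_side_def)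
    have z: "a i \<bullet> z = (1 - u) * (a i \<bullet> x) + u * (a i \<bullet> y)"
      by (simp add: z_def inner_add_right)
    show ?thesis
    proof (cases "a i \<bullet> x > b i")
      case True
      then show ?thesis
        using convex_bound_lt[of "- (a i \<bullet> x)" "- b i" "- (a i \<bullet> y)" "1 - u" u] iff assms(4,5) z by auto
    next
      case False
      then show ?thesis
        using convex_bound_lt[of "a i \<bullet> x" "b i" "a i \<bullet> y" "1 - u" u] iff assms(4,5) z x by auto
    qed
  qed
  show "z \<in> complement a b I" "positive_side a b I z = positive_side a b I x"
    using * by (auto simp: complement_def positive_side_def)
qed

text \<open>Deletion-restriction. Let \<open>P\<close> and \<open>N\<close> be the old patterns that
  occur on the positive and on the negative side of hyperplane \<open>i\<close>. The new count is
  \<open>card P + card N\<close>, hence that of the union plus that of the intersection. The union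
  is every old pattern, and the intersection consists of the patterns realised on the hyperplane
  itself.\<close>

lemma card_patterns_insert:
  assumes I: "finite I" "i \<notin> I" and V: "affine V" and out: "\<not> V \<subseteq> {x. a i \<bullet> x = b i}"
  shows "card (patterns a b (insert i I) V) =
    card (patterns a b I V) + card (patterns a b I (V \<inter> {x. a i \<bullet> x = b i}))"
proof -
  define P where "P = positive_side a b I ` (V \<inter> complement a b I \<inter> {x. a i \<bullet> x > b i})"
  define N where "N = positive_side a b I ` (V \<inter> complement a b I \<inter> {x. a i \<bullet> x < b i})"
  have sub: "P \<subseteq> Pow I" "N \<subseteq> Pow I" by (auto simp: P_def N_def positive_side_def)
  then have fin: "finite P" "finite N" using I(1) by (auto intro: finite_subset)
  have both: "\<exists>y\<in>V \<inter> complement a b I. positive_side a b I y = positive_side a b I x \<and> a i \<bullet> y > b i"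
             "\<exists>y\<in>V \<inter> complement a b I. positive_side a b I y = positive_side a b I x \<and> a i \<bullet> y < b i"
    if x: "x \<in> V" "x \<in> complement a b I" "a i \<bullet> x = b i" for x
  proof -
    obtain y where y: "y \<in> V" "a i \<bullet> y \<noteq> b i" using out by blast
    obtain e where e: "e > 0" "\<And>s. \<bar>s\<bar> < e \<Longrightarrow> x + s *\<^sub>R (y - x) \<in> complement a b I
           \<and> positive_side a b I (x + s *\<^sub>R (y - x)) = positive_side a b I x"
      using perturbation_keeps_side[OF I(1) x(2)] by metis
    have mem: "x + s *\<^sub>R (y - x) \<in> V" for s
      using mem_affine[OF V x(1) y(1), of "1 - s" s] by (simp add: algebra_simps)
    have val: "a i \<bullet> (x + s *\<^sub>R (y - x)) = b i + s * (a i \<bullet> y - b i)" for s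
      by (simp add: inner_add_right inner_diff_right x(3))
    \<comment> \<open>The sign of \<open>d\<close> is chosen so that a step by \<open>d\<close>
      along \<open>y - x\<close> enters the positive side, and a step by \<open>- d\<close> the
      negative side.\<close>
    define d where "d = (if a i \<bullet> y > b i then e / 2 else - e / 2)"
    have d: "\<bar>d\<bar> < e" "\<bar>- d\<bar> < e" "d * (a i \<bullet> y - b i) > 0"
      using e(1) y(2) by (auto simp: d_def mult_neg_neg mult_pos_neg)
    show "\<exists>y\<in>V \<inter> complement a b I. positive_side a b I y = positive_side a b I x \<and> a i \<bullet> y > b i"
      by (rule bexI[of _ "x + d *\<^sub>R (y - x)"]) (use mem[of d] val[of d] d e(2)[of d] in auto)
    show "\<exists>y\<in>V \<inter> complement a b I. positive_side a b I y = positive_side a b I x \<and> a i \<bullet> y < b i"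
      by (rule bexI[of _ "x + (- d) *\<^sub>R (y - x)"]) (use mem[of "-d"] val[of "-d"] d e(2)[of "-d"] in auto)
  qed
  have ins: "positive_side a b (insert i I) x =
      (if a i \<bullet> x > b i then insert i (positive_side a b I x) else positive_side a b I x)" for x
    by (auto simp: positive_side_def)
  have "patterns a b (insert i I) V = insert i ` P \<union> N"
  proof (intro equalityI subsetI)
    fix s assume "s \<in> patterns a b (insert i I) V"
    then obtain x where x: "x \<in> V" "x \<in> complement a b (insert i I)" "s = positive_side a b (insert i I) x"
      by (auto simp: patterns_def)
    then have "x \<in> complement a b I" "a i \<bullet> x > b i \<or> a i \<bullet> x < b i"
      by (auto simp: complement_def)
    with x show "s \<in> insert i ` P \<union> N" unfolding P_def N_def ins by auto
  next
    fix s assume "s \<in> insert i ` P \<union> N"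
    then obtain x where "x \<in> V" "x \<in> complement a b (insert i I)" "s = positive_side a b (insert i I) x"
      unfolding P_def N_def by (auto simp: ins complement_def)
    then show "s \<in> patterns a b (insert i I) V" by (auto simp: patterns_def)
  qed
  moreover have "insert i ` P \<inter> N = {}" using sub I(2) by auto
  moreover have "inj_on (insert i) P"
    using sub I(2) by (intro inj_onI) (metis PowD insert_ident subsetD)
  ultimately have "card (patterns a b (insert i I) V) = card P + card N"
    using fin by (simp add: card_Un_disjoint card_image)
  also have "\<dots> = card (P \<union> N) + card (P \<inter> N)" using fin by (rule card_Un_Int)
  also have "P \<union> N = patterns a b I V"
  proof
    show "P \<union> N \<subseteq> patterns a b I V" by (auto simp: P_def N_def patterns_def)
    show "patterns a b I V \<subseteq> P \<union> N"
    proof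
      fix s assume "s \<in> patterns a b I V"
      then obtain x where x: "x \<in> V" "x \<in> complement a b I" "s = positive_side a b I x"
        by (auto simp: patterns_def)
      consider "a i \<bullet> x > b i" | "a i \<bullet> x < b i" | "a i \<bullet> x = b i" by linarith
      then show "s \<in> P \<union> N"
      proof cases
        case 3
        from both(1)[OF x(1,2) 3] have "s \<in> P" unfolding P_def x(3) by (auto simp: image_iff)
        then show ?thesis by simp
      qed (use x in \<open>auto simp: P_def N_def\<close>)
    qed
  qed
  also have "P \<inter> N = patterns a b I (V \<inter> {x. a i \<bullet> x = b i})"
  proof (intro equalityI subsetI)
    fix s assume "s \<in> P \<inter> N"
    then obtain x y where x: "x \<in> V" "x \<in> complement a b I" "a i \<bullet> x > b i" "s = positive_side a b I x"
      and y: "y \<in> V" "y \<in> complement a b I" "a i \<bullet> y < b i" "s = positive_side a b I y"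
      unfolding P_def N_def by auto
    \<comment> \<open>The parameter at which the segment from \<open>x\<close> to \<open>y\<close>
      crosses hyperplane \<open>i\<close>; by convexity the crossing point keeps the pattern
      \<open>s\<close>.\<close>
    define u where "u = (a i \<bullet> x - b i) / (a i \<bullet> x - a i \<bullet> y)"
    have u: "0 \<le> u" "u \<le> 1" using x(3) y(3) by (auto simp: u_def field_simps)
    define z where "z = (1 - u) *\<^sub>R x + u *\<^sub>R y"
    have "z \<in> V" unfolding z_def using mem_affine[OF V x(1) y(1)] by simp
    moreover have "z \<in> complement a b I" "positive_side a b I z = s"
      using same_side_convex[OF x(2) y(2) _ u] x(4) y(4) by (auto simp: z_def)
    moreover have "a i \<bullet> z = b i"
    proof -
      have "a i \<bullet> z = a i \<bullet> x - u * (a i \<bullet> x - a i \<bullet> y)"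
        by (simp add: z_def inner_add_right algebra_simps)
      also have "u * (a i \<bullet> x - a i \<bullet> y) = a i \<bullet> x - b i" using x(3) y(3) by (simp add: u_def)
      finally show ?thesis by simp
    qed
    ultimately show "s \<in> patterns a b I (V \<inter> {x. a i \<bullet> x = b i})" by (auto simp: patterns_def)
  next
    fix s assume "s \<in> patterns a b I (V \<inter> {x. a i \<bullet> x = b i})"
    then obtain x where x: "x \<in> V" "x \<in> complement a b I" "a i \<bullet> x = b i" "s = positive_side a b I x"
      by (auto simp: patterns_def)
    from both[OF x(1-3)] show "s \<in> P \<inter> N" unfolding P_def N_def x(4) by (auto simp: image_iff)
  qed
  finally show ?thesis .
qed

lemma sum_Pow_insert:
  fixes g :: "'i set \<Rightarrow> 'b::comm_monoid_add"
  assumes "finite I" "i \<notin> I"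
  shows "(\<Sum>B\<in>Pow (insert i I). g B) = (\<Sum>B\<in>Pow I. g B) + (\<Sum>B\<in>Pow I. g (insert i B))"
proof -
  have "inj_on (insert i) (Pow I)"
    using assms(2) by (intro inj_onI) (metis PowD insert_ident subsetD)
  moreover have "Pow I \<inter> insert i ` Pow I = {}" using assms(2) by auto
  ultimately show ?thesis
    using assms(1) by (simp add: Pow_insert sum.union_disjoint sum.reindex)
qed

text \<open>The right side is Whitney's expansion at -1, and both sides obey the
  deletion-restriction recurrence. The affine set \<open>V\<close> is arbitrary because restriction
  replaces it by \<open>V \<inter> H\<close>.\<close>

lemma zaslavsky:
  assumes "finite I" "affine V"
  shows "(- 1) ^ nat (aff_dim V) * real (card (patterns a b I V)) =
    (\<Sum>B\<in>Pow I. (- 1) ^ card B * dim_sign (V \<inter> flat a b B))"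
  using assms
proof (induction I arbitrary: V rule: finite_induct)
  case empty
  show ?case
    by (cases "V = {}") (auto simp: patterns_def dim_sign_def flat_def complement_def positive_side_def image_constant_conv)
next
  case (insert i I)
  define H where "H = {x. a i \<bullet> x = b i}"
  have aff: "affine (V \<inter> H)" unfolding H_def by (intro affine_Int insert.prems affine_hyperplane)
  have "(\<Sum>B\<in>Pow I. (- 1) ^ card (insert i B) * dim_sign (V \<inter> flat a b (insert i B))) =
      - (\<Sum>B\<in>Pow I. (- 1) ^ card B * dim_sign ((V \<inter> H) \<inter> flat a b B))"
    unfolding sum_negf[symmetric]
  proof (intro sum.cong refl)
    fix B assume "B \<in> Pow I"
    then have "finite B" "i \<notin> B" using insert.hyps by (auto intro: finite_subset)
    moreover have "V \<inter> flat a b (insert i B) = (V \<inter> H) \<inter> flat a b B"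
      by (auto simp: flat_def H_def)
    ultimately show "(- 1) ^ card (insert i B) * dim_sign (V \<inter> flat a b (insert i B)) =
        - ((- 1) ^ card B * dim_sign ((V \<inter> H) \<inter> flat a b B))" by simp
  qed
  then have rhs: "(\<Sum>B\<in>Pow (insert i I). (- 1) ^ card B * dim_sign (V \<inter> flat a b B)) =
      (- 1) ^ nat (aff_dim V) * real (card (patterns a b I V))
      - (- 1) ^ nat (aff_dim (V \<inter> H)) * real (card (patterns a b I (V \<inter> H)))"
    unfolding sum_Pow_insert[OF insert.hyps] insert.IH[OF insert.prems] insert.IH[OF aff] by simp
  show ?case
  proof (cases "V \<subseteq> H")
    \<comment> \<open>All of \<open>V\<close> lies on hyperplane \<open>i\<close>: no pattern is
      left, and the deletion and restriction terms of \<open>rhs\<close> cancel.\<close>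
    case True
    then have "patterns a b (insert i I) V = {}"
      by (auto simp: patterns_def complement_def H_def)
    moreover have "V \<inter> H = V" using True by auto
    ultimately show ?thesis using rhs by simp
  next
    case False
    have card: "card (patterns a b (insert i I) V) = card (patterns a b I V) + card (patterns a b I (V \<inter> H))"
      using card_patterns_insert[OF insert.hyps insert.prems, of a b] False by (simp add: H_def)
    show ?thesis
    proof (cases "V \<inter> H = {}")
      case True
      \<comment> \<open>The hyperplane misses \<open>V\<close>, so the restriction term vanishes
        through its count 0.\<close>
      then show ?thesis using card rhs by (simp add: patterns_def)
    next
      case ne: False
      \<comment> \<open>A proper nonempty hyperplane section loses exactly one dimension, which
        turns the minus sign in \<open>rhs\<close> into the plus sign in
        \<open>card\<close>.\<close>
      have "aff_dim (V \<inter> H) = aff_dim V - 1"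
        using aff_dim_affine_Int_hyperplane[OF insert.prems, of "a i" "b i"] ne False
        by (simp add: H_def)
      moreover have "aff_dim (V \<inter> H) \<ge> 0" using ne aff_dim_negative_iff[of "V \<inter> H"] by linarith
      ultimately have "nat (aff_dim V) = Suc (nat (aff_dim (V \<inter> H)))" by linarith
      then show ?thesis using card rhs by (simp add: algebra_simps)
    qed
  qed
qed

section \<open>Whitney's theorem\<close>

text \<open>As \<open>mobius\<close> is a definite description, it is computed by exhibiting a
  solution of the recursion. Solutions are unique: the value at \<open>y\<close> depends only on
  values at elements strictly below \<open>y\<close>, whose lower intervals are strictly
  smaller.\<close>

lemma mobius_eqI:
  assumes fin: "finite P" and trans: "\<And>x y z. le x y \<Longrightarrow> le y z \<Longrightarrow> le x z"
    and antisym: "\<And>x y. le x y \<Longrightarrow> le y x \<Longrightarrow> x = y"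
    and m: "\<And>y. m y = (if y \<in> P \<and> le x y then
        (if y = x then 1 else - (\<Sum>z\<in>{z\<in>P. le x z \<and> le z y \<and> z \<noteq> y}. m z)) else 0)"
  shows "mobius P le x = m"
  unfolding mobius_def
proof (rule the_equality)
  show "\<forall>y. m y = (if y \<in> P \<and> le x y then
        (if y = x then 1 else - (\<Sum>z\<in>{z\<in>P. le x z \<and> le z y \<and> z \<noteq> y}. m z)) else 0)"
    using m by blast
next
  fix m' :: "'a \<Rightarrow> real"
  assume m': "\<forall>y. m' y = (if y \<in> P \<and> le x y then
        (if y = x then 1 else - (\<Sum>z\<in>{z\<in>P. le x z \<and> le z y \<and> z \<noteq> y}. m' z)) else 0)"
  have "m' y = m y" for y
  proof (induction "card {z\<in>P. le x z \<and> le z y \<and> z \<noteq> y}" arbitrary: y rule: less_induct)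
    case less
    have "m' z = m z" if "z \<in> {z\<in>P. le x z \<and> le z y \<and> z \<noteq> y}" for z
    proof (rule less, rule psubset_card_mono)
      show "finite {z\<in>P. le x z \<and> le z y \<and> z \<noteq> y}" using fin by simp
      show "{w\<in>P. le x w \<and> le w z \<and> w \<noteq> z} \<subset> {z\<in>P. le x z \<and> le z y \<and> z \<noteq> y}"
        using that trans antisym by blast
    qed
    then have eq: "(\<Sum>z\<in>{z\<in>P. le x z \<and> le z y \<and> z \<noteq> y}. m' z) = (\<Sum>z\<in>{z\<in>P. le x z \<and> le z y \<and> z \<noteq> y}. m z)"
      by (rule sum.cong[OF refl])
    show ?case by (subst m'[rule_format], subst m, subst eq, rule refl)
  qed
  then show "m' = m" by blast
qed

text \<open>Toggling one fixed element pairs each subset with one of opposite sign.\<close>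

lemma sum_Pow_minus_one_power:
  assumes "finite S" "S \<noteq> {}"
  shows "(\<Sum>B\<in>Pow S. (- 1 :: real) ^ card B) = 0"
proof -
  obtain i where "i \<in> S" using assms(2) by blast
  then have S: "S = insert i (S - {i})" "finite (S - {i})" "i \<notin> S - {i}" using assms(1) by auto
  have "(- 1 :: real) ^ card (insert i B) = - ((- 1) ^ card B)" if "B \<in> Pow (S - {i})" for B
  proof -
    have "finite B" "i \<notin> B" using that S(2) by (auto intro: finite_subset)
    then show ?thesis by simp
  qed
  then have "(\<Sum>B\<in>Pow (S - {i}). (- 1 :: real) ^ card (insert i B)) = - (\<Sum>B\<in>Pow (S - {i}). (- 1) ^ card B)"
    by (simp add: sum_negf)
  then have "(\<Sum>B\<in>Pow (insert i (S - {i})). (- 1 :: real) ^ card B) = 0"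
    unfolding sum_Pow_insert[OF S(2,3)] by simp
  then show ?thesis unfolding S(1)[symmetric] .
qed

text \<open>Summed over all flats containing \<open>X\<close>, the right side becomes an alternating
  sum over all sets of hyperplanes through \<open>X\<close>. That is 1 if there is no such
  hyperplane and 0 otherwise, which is the defining recursion.\<close>

lemma mobius_intersection_poset:
  fixes A :: "'a set set"
  assumes fin: "finite A" and proper: "UNIV \<notin> A"
  defines "L \<equiv> intersection_poset A"
  shows "mobius L (\<lambda>X Y. Y \<subseteq> X) UNIV =
    (\<lambda>X. if X \<in> L then \<Sum>B\<in>{B\<in>Pow A. \<Inter>B = X}. (- 1) ^ card B else 0)"
proof -
  define m :: "'a set \<Rightarrow> real" where
    "m X = (if X \<in> L then \<Sum>B\<in>{B\<in>Pow A. \<Inter>B = X}. (- 1) ^ card B else 0)" for X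
  have "mobius L (\<lambda>X Y. Y \<subseteq> X) UNIV = m"
  proof (rule mobius_eqI)
    have L_eq: "L = {X \<in> Inter ` Pow A. X \<noteq> {}}" unfolding L_def intersection_poset_def by auto
    show finL: "finite L" using fin by (simp add: L_eq)
    fix X
    show "m X = (if X \<in> L \<and> X \<subseteq> UNIV then
          (if X = UNIV then 1 else - (\<Sum>Z\<in>{Z\<in>L. Z \<subseteq> UNIV \<and> X \<subseteq> Z \<and> Z \<noteq> X}. m Z)) else 0)"
    proof (cases "X \<in> L")
      case XL: True
      \<comment> \<open>A subfamily \<open>B\<close> of \<open>A\<close> satisfies
        \<open>X \<subseteq> \<Inter>B\<close> exactly when \<open>B \<subseteq> S\<close>, so
        grouping \<open>Pow S\<close> by intersections yields the sum of \<open>m\<close> over the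
        flats containing \<open>X\<close>.\<close>
      define S where "S = {H\<in>A. X \<subseteq> H}"
      have finS: "finite S" using fin by (simp add: S_def)
      have "(\<Sum>Z\<in>{Z\<in>L. X \<subseteq> Z}. m Z) =
          (\<Sum>Z\<in>{Z\<in>L. X \<subseteq> Z}. \<Sum>B\<in>{B\<in>Pow S. \<Inter>B = Z}. (- 1) ^ card B)"
        by (intro sum.cong refl) (auto simp: S_def m_def intro!: sum.cong)
      also have "\<dots> = (\<Sum>B\<in>Pow S. (- 1) ^ card B)"
      proof (rule sum.group)
        show "Inter ` Pow S \<subseteq> {Z \<in> L. X \<subseteq> Z}"
        proof (intro image_subsetI)
          fix B assume "B \<in> Pow S"
          then have "B \<subseteq> A" "X \<subseteq> \<Inter>B" by (auto simp: S_def)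
          moreover have "X \<noteq> {}" using XL by (simp add: L_eq)
          ultimately show "\<Inter>B \<in> {Z \<in> L. X \<subseteq> Z}" by (auto simp: L_eq)
        qed
      qed (use finS finL in auto)
      finally have sum: "(\<Sum>Z\<in>{Z\<in>L. X \<subseteq> Z}. m Z) = (\<Sum>B\<in>Pow S. (- 1) ^ card B)" .
      have split: "{Z\<in>L. X \<subseteq> Z} = insert X {Z\<in>L. X \<subseteq> Z \<and> Z \<noteq> X}" using XL by auto
      have "(\<Sum>Z\<in>{Z\<in>L. X \<subseteq> Z}. m Z) = m X + (\<Sum>Z\<in>{Z\<in>L. X \<subseteq> Z \<and> Z \<noteq> X}. m Z)"
        unfolding split by (subst sum.insert) (use finL in auto)
      with sum have rec: "m X + (\<Sum>Z\<in>{Z\<in>L. X \<subseteq> Z \<and> Z \<noteq> X}. m Z) = (\<Sum>B\<in>Pow S. (- 1) ^ card B)"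
        by simp
      show ?thesis
      proof (cases "X = UNIV")
        case True
        \<comment> \<open>This is where \<open>UNIV \<notin> A\<close> enters: no member of
          \<open>A\<close> contains the whole space, so the alternating sum is 1.\<close>
        have "S = {}" using True proper by (auto simp: S_def top.extremum_unique)
        moreover have none: "{Z\<in>L. X \<subseteq> Z \<and> Z \<noteq> X} = {}" using True by auto
        ultimately have "m X = 1" using rec unfolding none by simp
        then show ?thesis using XL True by simp
      next
        case False
        obtain B where "B \<subseteq> A" "X = \<Inter>B" using XL by (auto simp: L_eq)
        with False have "S \<noteq> {}" by (auto simp: S_def)
        from sum_Pow_minus_one_power[OF finS this] rec
        have "m X = - (\<Sum>Z\<in>{Z\<in>L. X \<subseteq> Z \<and> Z \<noteq> X}. m Z)" by simp
        moreover have "{Z\<in>L. Z \<subseteq> UNIV \<and> X \<subseteq> Z \<and> Z \<noteq> X} = {Z\<in>L. X \<subseteq> Z \<and> Z \<noteq> X}" by simp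
        ultimately show ?thesis using XL False by simp
      qed
    qed (simp add: m_def)
  qed auto
  then show ?thesis by (simp add: m_def fun_eq_iff)
qed

text \<open>The subset formula for the Moebius function is inserted and the sum regrouped: each
  subfamily with nonempty intersection belongs to exactly one flat.\<close>

lemma whitney:
  fixes A :: "(real^'n::finite) set set"
  assumes fin: "finite A" and proper: "UNIV \<notin> A"
  shows "char_poly A t = (\<Sum>B\<in>{B\<in>Pow A. \<Inter>B \<noteq> {}}. (- 1) ^ card B * t ^ nat (aff_dim (\<Inter>B)))"
proof -
  define L where "L = intersection_poset A"
  have L_eq: "L = Inter ` {B\<in>Pow A. \<Inter>B \<noteq> {}}" unfolding L_def intersection_poset_def by auto
  have "char_poly A t = (\<Sum>X\<in>L. \<Sum>B\<in>{B\<in>{B\<in>Pow A. \<Inter>B \<noteq> {}}. \<Inter>B = X}. (- 1) ^ card B * t ^ nat (aff_dim (\<Inter>B)))"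
    unfolding char_poly_def L_def[symmetric] mobius_intersection_poset[OF fin proper, folded L_def]
  proof (intro sum.cong refl)
    fix X assume X: "X \<in> L"
    then have "X \<noteq> {}" by (auto simp: L_eq)
    then have "{B\<in>{B\<in>Pow A. \<Inter>B \<noteq> {}}. \<Inter>B = X} = {B\<in>Pow A. \<Inter>B = X}" by auto
    with X show "(if X \<in> L then \<Sum>B\<in>{B\<in>Pow A. \<Inter>B = X}. (- 1) ^ card B else 0) * t ^ nat (aff_dim X) =
       (\<Sum>B\<in>{B\<in>{B\<in>Pow A. \<Inter>B \<noteq> {}}. \<Inter>B = X}. (- 1) ^ card B * t ^ nat (aff_dim (\<Inter>B)))"
      by (simp add: sum_distrib_right)
  qed
  also have "\<dots> = (\<Sum>B\<in>{B\<in>Pow A. \<Inter>B \<noteq> {}}. (- 1) ^ card B * t ^ nat (aff_dim (\<Inter>B)))"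
    by (rule sum.group) (use fin in \<open>auto simp: L_eq\<close>)
  finally show ?thesis .
qed

section \<open>Integer points in recession cones\<close>

text \<open>Membership in the recession cone of the region with sign pattern \<open>s\<close>, given
  by the homogeneous weak inequalities; the offsets \<open>b\<close> do not enter.\<close>

definition recedes :: "('i \<Rightarrow> 'e::euclidean_space) \<Rightarrow> 'i set \<Rightarrow> 'i set \<Rightarrow> 'e \<Rightarrow> bool" where
  "recedes a I s v \<longleftrightarrow> (\<forall>i\<in>I. if i \<in> s then a i \<bullet> v \<ge> 0 else a i \<bullet> v \<le> 0)"

text \<open>Restricting a pattern to the hyperplanes parallel to \<open>v\<close> is a bijection.
  For the other hyperplanes the sign of \<open>a i \<bullet> v\<close> dictates the side, which
  gives injectivity; a point moved far enough along \<open>v\<close> attains these sides without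
  changing the parallel ones, which gives surjectivity.\<close>

lemma card_patterns_parallel:
  assumes "finite I"
  shows "card (patterns a b {i\<in>I. a i \<bullet> v = 0} UNIV) = card {s\<in>patterns a b I UNIV. recedes a I s v}"
proof -
  define J where "J = {i\<in>I. a i \<bullet> v = 0}"
  have "bij_betw (\<lambda>s. s \<inter> J) {s\<in>patterns a b I UNIV. recedes a I s v} (patterns a b J UNIV)"
    unfolding bij_betw_def
  proof (rule conjI; (rule inj_onI | (rule equalityI; rule subsetI)))
    fix s s' assume s: "s \<in> {s\<in>patterns a b I UNIV. recedes a I s v}"
      and s': "s' \<in> {s\<in>patterns a b I UNIV. recedes a I s v}" and eq: "s \<inter> J = s' \<inter> J"
    have sub: "s \<subseteq> I" "s' \<subseteq> I" using s s' by (auto simp: patterns_def positive_side_def)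
    have "i \<in> s \<longleftrightarrow> i \<in> s'" if "i \<in> I" for i
    proof (cases "i \<in> J")
      case True
      then show ?thesis using eq by blast
    next
      case False
      then have "a i \<bullet> v \<noteq> 0" using that by (simp add: J_def)
      moreover have "if i \<in> s then a i \<bullet> v \<ge> 0 else a i \<bullet> v \<le> 0" "if i \<in> s' then a i \<bullet> v \<ge> 0 else a i \<bullet> v \<le> 0"
        using s s' that unfolding recedes_def by blast+
      ultimately show ?thesis by (auto split: if_splits)
    qed
    with sub show "s = s'" by blast
  next
    fix r assume "r \<in> (\<lambda>s. s \<inter> J) ` {s\<in>patterns a b I UNIV. recedes a I s v}"
    then obtain x where "x \<in> complement a b I" "r = positive_side a b I x \<inter> J"
      by (auto simp: patterns_def)
    then have "x \<in> complement a b J" "r = positive_side a b J x"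
      by (auto simp: J_def complement_def positive_side_def)
    then show "r \<in> patterns a b J UNIV" by (auto simp: patterns_def)
  next
    fix r assume "r \<in> patterns a b J UNIV"
    then obtain x where x: "x \<in> complement a b J" "r = positive_side a b J x"
      by (auto simp: patterns_def)
    have "\<forall>\<^sub>F t in at_top. \<forall>i\<in>I. (a i \<bullet> v > 0 \<longrightarrow> a i \<bullet> (x + t *\<^sub>R v) > b i)
        \<and> (a i \<bullet> v < 0 \<longrightarrow> a i \<bullet> (x + t *\<^sub>R v) < b i)"
    proof (intro eventually_ball_finite assms ballI)
      fix i
      show "\<forall>\<^sub>F t in at_top. (a i \<bullet> v > 0 \<longrightarrow> a i \<bullet> (x + t *\<^sub>R v) > b i)
        \<and> (a i \<bullet> v < 0 \<longrightarrow> a i \<bullet> (x + t *\<^sub>R v) < b i)"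
        \<comment> \<open>Beyond this threshold the point has passed hyperplane \<open>i\<close>. If
          \<open>a i \<bullet> v = 0\<close>, both implications are vacuous.\<close>
        using eventually_gt_at_top[of "(b i - a i \<bullet> x) / (a i \<bullet> v)"]
        by eventually_elim (auto simp: inner_add_right field_simps)
    qed
    then obtain t where t: "\<And>i. i \<in> I \<Longrightarrow> a i \<bullet> v > 0 \<Longrightarrow> a i \<bullet> (x + t *\<^sub>R v) > b i"
        "\<And>i. i \<in> I \<Longrightarrow> a i \<bullet> v < 0 \<Longrightarrow> a i \<bullet> (x + t *\<^sub>R v) < b i"
      unfolding eventually_at_top_linorder by blast
    define y where "y = x + t *\<^sub>R v"
    have J: "a i \<bullet> y = a i \<bullet> x" if "i \<in> J" for i using that by (simp add: J_def y_def inner_add_right)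
    have y: "y \<in> complement a b I"
      unfolding complement_def
    proof (intro CollectI ballI)
      fix i assume i: "i \<in> I"
      consider "a i \<bullet> v > 0" | "a i \<bullet> v < 0" | "i \<in> J" using i by (cases "a i \<bullet> v" "0::real" rule: linorder_cases) (auto simp: J_def)
      then show "a i \<bullet> y \<noteq> b i"
        using t[OF i] J x(1) by cases (auto simp: y_def complement_def)
    qed
    have "recedes a I (positive_side a b I y) v"
      unfolding recedes_def
    proof
      fix i assume i: "i \<in> I"
      show "if i \<in> positive_side a b I y then a i \<bullet> v \<ge> 0 else a i \<bullet> v \<le> 0"
        using t[OF i] i by (cases "a i \<bullet> v" "0::real" rule: linorder_cases) (auto simp: positive_side_def y_def)
    qed
    moreover have "positive_side a b I y \<inter> J = r" using J by (auto simp: x(2) positive_side_def J_def)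
    ultimately show "r \<in> (\<lambda>s. s \<inter> J) ` {s\<in>patterns a b I UNIV. recedes a I s v}"
      using y by (auto simp: patterns_def)
  qed
  then show ?thesis unfolding J_def by (simp add: bij_betw_same_card)
qed

section \<open>Counting integer points of a box\<close>

definition nat_maps :: "nat \<Rightarrow> ('n \<Rightarrow> nat) set" where
  "nat_maps t = {f. \<forall>i. f i < t}"

lemma finite_nat_maps: "finite (nat_maps t :: ('n::finite \<Rightarrow> nat) set)"
proof -
  have "nat_maps t = (UNIV :: 'n set) \<rightarrow>\<^sub>E {..<t}" by (auto simp: nat_maps_def PiE_def)
  then show ?thesis by (simp add: finite_PiE)
qed

text \<open>A map that is constant on the fibres of \<open>\<phi>\<close> factors uniquely through
  \<open>\<phi>\<close>; \<open>P\<close> is the condition \<open>Q\<close> read on the classes. The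
  maps \<open>g\<close> are extensional, so that distinct ones differ on the range.\<close>

lemma card_nat_maps_factor:
  fixes \<phi> :: "'n::finite \<Rightarrow> 'c"
  assumes "\<And>f. Q f \<Longrightarrow> (\<forall>i j. \<phi> i = \<phi> j \<longrightarrow> f i = f j)"
    and "\<And>g. g \<in> range \<phi> \<rightarrow>\<^sub>E {..<t} \<Longrightarrow> P g \<longleftrightarrow> Q (\<lambda>i. g (\<phi> i))"
  shows "card {f\<in>nat_maps t. Q f} = card {g\<in>range \<phi> \<rightarrow>\<^sub>E {..<t}. P g}"
proof -
  have "bij_betw (\<lambda>g i. g (\<phi> i)) {g\<in>range \<phi> \<rightarrow>\<^sub>E {..<t}. P g} {f\<in>nat_maps t. Q f}"
    unfolding bij_betw_def
  proof (rule conjI; (rule inj_onI | (rule equalityI; rule subsetI)))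
    fix g h assume "g \<in> {g\<in>range \<phi> \<rightarrow>\<^sub>E {..<t}. P g}" "h \<in> {g\<in>range \<phi> \<rightarrow>\<^sub>E {..<t}. P g}"
      and "(\<lambda>i. g (\<phi> i)) = (\<lambda>i. h (\<phi> i))"
    then show "g = h" by (intro PiE_ext[of g "range \<phi>" _ h]) (auto simp: fun_eq_iff)
  next
    fix f assume "f \<in> (\<lambda>g i. g (\<phi> i)) ` {g\<in>range \<phi> \<rightarrow>\<^sub>E {..<t}. P g}"
    then obtain g where g: "g \<in> range \<phi> \<rightarrow>\<^sub>E {..<t}" "P g" "f = (\<lambda>i. g (\<phi> i))" by blast
    then have "Q f" using assms(2)[of g] by blast
    moreover have "f i < t" for i using PiE_mem[OF g(1), of "\<phi> i"] by (simp add: g(3))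
    ultimately show "f \<in> {f\<in>nat_maps t. Q f}" by (simp add: nat_maps_def)
  next
    fix f assume f: "f \<in> {f\<in>nat_maps t. Q f}"
    \<comment> \<open>The factor reads \<open>f\<close> at a chosen representative of each
      class.\<close>
    define g where "g = restrict (\<lambda>c. f (inv \<phi> c)) (range \<phi>)"
    have "f (inv \<phi> (\<phi> i)) = f i" for i
    proof -
      have "\<phi> (inv \<phi> (\<phi> i)) = \<phi> i" by (simp add: f_inv_into_f)
      then show ?thesis using assms(1)[of f] f by blast
    qed
    then have fg: "f = (\<lambda>i. g (\<phi> i))" by (auto simp: g_def)
    moreover have g: "g \<in> range \<phi> \<rightarrow>\<^sub>E {..<t}" using f by (auto simp: g_def nat_maps_def)
    moreover have "P g" using assms(2)[OF g] f fg by simp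
    ultimately show "f \<in> (\<lambda>g i. g (\<phi> i)) ` {g\<in>range \<phi> \<rightarrow>\<^sub>E {..<t}. P g}" by blast
  qed
  then show ?thesis by (simp add: bij_betw_same_card)
qed

lemma card_nat_maps_constant_on_classes:
  fixes \<phi> :: "'n::finite \<Rightarrow> 'c"
  shows "card {f\<in>nat_maps t. \<forall>i j. \<phi> i = \<phi> j \<longrightarrow> f i = f j} = t ^ card (range \<phi>)"
proof -
  have "card {f\<in>nat_maps t. \<forall>i j. \<phi> i = \<phi> j \<longrightarrow> f i = f j} = card {g\<in>range \<phi> \<rightarrow>\<^sub>E {..<t}. True}"
  proof (rule card_nat_maps_factor)
    show "\<forall>i j. \<phi> i = \<phi> j \<longrightarrow> f i = f j" if "\<forall>i j. \<phi> i = \<phi> j \<longrightarrow> f i = f j" for f :: "'n \<Rightarrow> nat"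
      using that .
    show "True \<longleftrightarrow> (\<forall>i j. \<phi> i = \<phi> j \<longrightarrow> g (\<phi> i) = g (\<phi> j))" for g :: "'c \<Rightarrow> nat"
      by simp
  qed
  then show ?thesis by (simp add: card_PiE)
qed

text \<open>Multisets of size \<open>card S\<close> from \<open>t\<close> values. With
  \<open>m\<close> the largest argument, a map into \<open>{..<Suc t}\<close> either has
  \<open>g m < t\<close> and hence all values below \<open>t\<close>, or has \<open>g m = t\<close>
  and is any monotone map on the rest. This is Pascal's rule. Truncated subtraction gives the
  correct value 1 when \<open>S\<close> is empty and \<open>t = 0\<close>.\<close>

lemma card_mono_maps:
  fixes S :: "nat set"
  assumes "finite S"
  shows "card {g\<in>S \<rightarrow>\<^sub>E {..<t}. mono_on S g} = (t + card S - 1) choose card S"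
  using assms
proof (induction S arbitrary: t rule: finite_linorder_max_induct)
  case empty
  have "{g\<in>{} \<rightarrow>\<^sub>E {..<t}. mono_on {} g} = {\<lambda>x. undefined}" by auto
  then show ?case by simp
next
  case (insert m S)
  have m: "m \<notin> S" using insert.hyps(2) by blast
  show ?case
  proof (induction t)
    \<comment> \<open>There is no map to an empty set, and \<open>k - 1\<close> over
      \<open>k\<close> is 0 since \<open>k \<ge> 1\<close> after the insertion.\<close>
    case 0
    have none: "{g\<in>insert m S \<rightarrow>\<^sub>E {..<0::nat}. mono_on (insert m S) g} = {}"
      by (auto simp: PiE_iff)
    show ?case unfolding none using m insert.hyps(1) by simp
  next
    case (Suc t)
    define X where "X = {g\<in>insert m S \<rightarrow>\<^sub>E {..<Suc t}. mono_on (insert m S) g}"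
    define Y where "Y = {g\<in>S \<rightarrow>\<^sub>E {..<Suc t}. mono_on S g}"
    have fin: "finite X" unfolding X_def using insert.hyps(1) by (simp add: finite_PiE)
    have "{g\<in>X. g m < t} = {g\<in>insert m S \<rightarrow>\<^sub>E {..<t}. mono_on (insert m S) g}"
    proof (intro equalityI subsetI)
      fix g assume g: "g \<in> {g\<in>X. g m < t}"
      have "g x < t" if "x \<in> insert m S" for x
      proof -
        have "x \<le> m" using that insert.hyps(2) by auto
        then have "g x \<le> g m" using g that by (auto simp: X_def intro: mono_onD)
        then show ?thesis using g by simp
      qed
      then show "g \<in> {g\<in>insert m S \<rightarrow>\<^sub>E {..<t}. mono_on (insert m S) g}"
        using g unfolding X_def by (auto simp: PiE_iff)
    next
      fix g assume "g \<in> {g\<in>insert m S \<rightarrow>\<^sub>E {..<t}. mono_on (insert m S) g}"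
      then show "g \<in> {g\<in>X. g m < t}" unfolding X_def by (auto simp: PiE_iff less_SucI)
    qed
    moreover have "bij_betw (\<lambda>g. g(m := t)) Y {g\<in>X. g m = t}"
      unfolding bij_betw_def
    proof (rule conjI; (rule inj_onI | (rule equalityI; rule subsetI)))
      fix g h assume gh: "g \<in> Y" "h \<in> Y" "g(m := t) = h(m := t)"
      have "g x = h x" if "x \<in> S" for x
        using fun_cong[OF gh(3), of x] m that by (auto split: if_splits)
      then show "g = h" using gh(1,2) by (intro PiE_ext[of g S _ h]) (auto simp: Y_def)
    next
      fix g assume "g \<in> (\<lambda>g. g(m := t)) ` Y"
      then obtain h where h: "h \<in> Y" "g = h(m := t)" by blast
      have "h x \<le> t" if "x \<in> S" for x using h(1) that by (auto simp: Y_def PiE_iff less_Suc_eq_le)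
      then have "mono_on (insert m S) g"
        using h insert.hyps(2) by (fastforce simp: Y_def mono_on_def)
      moreover have "g \<in> insert m S \<rightarrow>\<^sub>E {..<Suc t}"
        using h by (auto simp: Y_def PiE_iff extensional_def)
      ultimately show "g \<in> {g\<in>X. g m = t}" using h(2) by (simp add: X_def)
    next
      fix g assume g: "g \<in> {g\<in>X. g m = t}"
      have "restrict g S \<in> Y" using g by (auto simp: X_def Y_def mono_on_def)
      moreover have "g = (restrict g S)(m := t)"
        using g by (auto simp: X_def PiE_iff extensional_def fun_eq_iff)
      ultimately show "g \<in> (\<lambda>g. g(m := t)) ` Y" by blast
    qed
    moreover have "X = {g\<in>X. g m < t} \<union> {g\<in>X. g m = t}" by (auto simp: X_def PiE_iff less_Suc_eq)
    then have "card X = card {g\<in>X. g m < t} + card {g\<in>X. g m = t}"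
      using fin by (subst card_Un_disjoint[symmetric]) auto
    ultimately have "card X = ((t + card (insert m S) - 1) choose card (insert m S)) + card Y"
      using Suc.IH by (simp add: bij_betw_same_card[symmetric])
    then show ?case
      using insert.IH[of "Suc t"] m insert.hyps(1) unfolding X_def Y_def by simp
  qed
qed

text \<open>Equal ranks force inequalities in both directions, so a monotone map factors through the
  chain \<open>range \<phi>\<close>.\<close>

lemma card_nat_maps_monotone:
  fixes \<phi> :: "'n::finite \<Rightarrow> nat"
  shows "card {f\<in>nat_maps t. \<forall>i j. \<phi> i \<le> \<phi> j \<longrightarrow> f i \<le> f j} = (t + card (range \<phi>) - 1) choose card (range \<phi>)"
proof -
  have "card {f\<in>nat_maps t. \<forall>i j. \<phi> i \<le> \<phi> j \<longrightarrow> f i \<le> f j} = card {g\<in>range \<phi> \<rightarrow>\<^sub>E {..<t}. mono_on (range \<phi>) g}"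
  proof (rule card_nat_maps_factor)
    show "\<forall>i j. \<phi> i = \<phi> j \<longrightarrow> f i = f j" if "\<forall>i j. \<phi> i \<le> \<phi> j \<longrightarrow> f i \<le> f j" for f :: "'n \<Rightarrow> nat"
      using that by (metis order_antisym order_refl)
  qed (auto simp: mono_on_def)
  then show ?thesis by (simp add: card_mono_maps)
qed

section \<open>Subspaces of vectors constant on classes\<close>

definition class_space :: "('n::finite \<Rightarrow> 'c) \<Rightarrow> (real^'n) set" where
  "class_space \<phi> = {v. \<forall>i j. \<phi> i = \<phi> j \<longrightarrow> v$i = v$j}"

lemma subspace_class_space:
  fixes \<phi> :: "'n::finite \<Rightarrow> 'c"
  shows "subspace (class_space \<phi>)"
proof (rule subspaceI)
  fix v w :: "real^'n" and c :: real
  show "0 \<in> class_space \<phi>" by (simp add: class_space_def)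
  assume v: "v \<in> class_space \<phi>"
  show "c *\<^sub>R v \<in> class_space \<phi>"
    unfolding class_space_def
  proof (intro CollectI allI impI)
    fix i j assume "\<phi> i = \<phi> j"
    then have "v$i = v$j" using v unfolding class_space_def by blast
    then show "(c *\<^sub>R v)$i = (c *\<^sub>R v)$j" by simp
  qed
  assume w: "w \<in> class_space \<phi>"
  show "v + w \<in> class_space \<phi>"
    unfolding class_space_def
  proof (intro CollectI allI impI)
    fix i j assume "\<phi> i = \<phi> j"
    then have "v$i = v$j" "w$i = w$j" using v w unfolding class_space_def by blast+
    then show "(v + w)$i = (v + w)$j" by simp
  qed
qed

text \<open>The indicator vectors of the classes are nonzero and pairwise orthogonal, and they span:
  the coefficient of a class is the value of the vector at a representative.\<close>

lemma dim_class_space: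
  fixes \<phi> :: "'n::finite \<Rightarrow> 'c"
  shows "dim (class_space \<phi>) = card (range \<phi>)"
proof -
  define e :: "'c \<Rightarrow> real^'n" where "e c = (\<chi> i. if \<phi> i = c then 1 else 0)" for c
  have ne: "e c \<noteq> 0" if "c \<in> range \<phi>" for c
    using that by (auto simp: e_def vec_eq_iff)
  have orth: "e c \<bullet> e d = 0" if "c \<noteq> d" for c d
  proof -
    have "e c $ i * e d $ i = 0" for i using that by (simp add: e_def)
    then show ?thesis unfolding inner_vec_def inner_real_def by (intro sum.neutral) blast
  qed
  have inj: "inj_on e (range \<phi>)"
  proof (rule inj_onI, rule ccontr)
    fix c d assume "c \<in> range \<phi>" "e c = e d" "c \<noteq> d"
    then show False using ne[of c] orth[of c d] by simp
  qed
  have indep: "independent (e ` range \<phi>)"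
  proof (rule pairwise_orthogonal_independent)
    show "pairwise orthogonal (e ` range \<phi>)"
    proof (rule pairwiseI)
      fix x y assume "x \<in> e ` range \<phi>" "y \<in> e ` range \<phi>" "x \<noteq> y"
      moreover from this obtain c d where "x = e c" "y = e d" by (elim imageE)
      ultimately show "orthogonal x y" using orth[of c d] unfolding orthogonal_def by auto
    qed
    show "0 \<notin> e ` range \<phi>" using ne by auto
  qed
  have sub: "e ` range \<phi> \<subseteq> class_space \<phi>" by (auto simp: e_def class_space_def)
  have span: "class_space \<phi> \<subseteq> span (e ` range \<phi>)"
  proof
    fix v :: "real^'n" assume v: "v \<in> class_space \<phi>"
    have "v = (\<Sum>c\<in>range \<phi>. v $ (inv \<phi> c) *\<^sub>R e c)"
    proof (subst vec_eq_iff, intro allI)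
      fix i
      have "(\<Sum>c\<in>range \<phi>. v $ (inv \<phi> c) *\<^sub>R e c) $ i = (\<Sum>c\<in>range \<phi>. if c = \<phi> i then v $ (inv \<phi> c) else 0)"
        unfolding sum_component by (rule sum.cong) (auto simp: e_def)
      also have "\<dots> = v $ (inv \<phi> (\<phi> i))" by (simp add: sum.delta)
      also have "\<dots> = v $ i"
      proof -
        have "\<phi> (inv \<phi> (\<phi> i)) = \<phi> i" by (simp add: f_inv_into_f)
        then show ?thesis using v unfolding class_space_def by blast
      qed
      finally show "v $ i = (\<Sum>c\<in>range \<phi>. v $ (inv \<phi> c) *\<^sub>R e c) $ i" by simp
    qed
    also have "\<dots> \<in> span (e ` range \<phi>)" by (intro span_sum span_scale span_base) auto
    finally show "v \<in> span (e ` range \<phi>)" .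
  qed
  show ?thesis using basis_card_eq_dim[OF sub span indep] inj by (simp add: card_image)
qed

section \<open>Regions and levels\<close>

definition region_of :: "('i \<Rightarrow> 'e::euclidean_space) \<Rightarrow> ('i \<Rightarrow> real) \<Rightarrow> 'i set \<Rightarrow> 'i set \<Rightarrow> 'e set" where
  "region_of a b I s = {x \<in> complement a b I. positive_side a b I x = s}"

lemma region_of_eq:
  assumes "s \<subseteq> I"
  shows "region_of a b I s = {x. \<forall>i\<in>I. if i \<in> s then a i \<bullet> x > b i else a i \<bullet> x < b i}"
proof (intro equalityI subsetI)
  fix x assume "x \<in> region_of a b I s"
  then show "x \<in> {x. \<forall>i\<in>I. if i \<in> s then a i \<bullet> x > b i else a i \<bullet> x < b i}"
    by (auto simp: region_of_def complement_def positive_side_def not_less order_less_le)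
next
  fix x assume x: "x \<in> {x. \<forall>i\<in>I. if i \<in> s then a i \<bullet> x > b i else a i \<bullet> x < b i}"
  then have "(i \<in> s \<longrightarrow> a i \<bullet> x > b i) \<and> (i \<notin> s \<longrightarrow> a i \<bullet> x < b i)" if "i \<in> I" for i
    using that by auto
  then show "x \<in> region_of a b I s"
    using assms by (fastforce simp: region_of_def complement_def positive_side_def)
qed

lemma region_of_nonempty: "s \<in> patterns a b I UNIV \<Longrightarrow> region_of a b I s \<noteq> {}"
  by (auto simp: patterns_def region_of_def)

lemma connected_region_of: "connected (region_of a b I s)"
proof (intro convex_connected)
  show "convex (region_of a b I s)"
    unfolding convex_alt region_of_def
    using same_side_convex[of _ a b I] by fastforce
qed

text \<open>By the intermediate value theorem a connected set with points on both sides of a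
  hyperplane meets that hyperplane.\<close>

lemma connected_imp_same_side:
  assumes C: "connected C" "C \<subseteq> complement a b I" "x \<in> C" "y \<in> C"
  shows "positive_side a b I x = positive_side a b I y"
proof -
  have half: "a i \<bullet> v > b i" if uv: "i \<in> I" "u \<in> C" "v \<in> C" "a i \<bullet> u > b i" for i u v
  proof (rule ccontr)
    assume "\<not> a i \<bullet> v > b i"
    with uv(4) obtain z where "z \<in> C" "a i \<bullet> z = b i"
      using connected_ivt_hyperplane[OF C(1) uv(3,2), of "a i" "b i"] by force
    then show False using C(2) uv(1) by (auto simp: complement_def)
  qed
  then show ?thesis using C(3,4) unfolding positive_side_def by blast
qed

text \<open>Cells of constant pattern are convex, hence connected, and a connected subset of the
  complement cannot leave its cell; the nonempty cells are therefore the maximal connected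
  subsets.\<close>

lemma components_complement:
  "components (complement a b I) = region_of a b I ` patterns a b I UNIV"
proof (intro equalityI subsetI)
  fix C assume C: "C \<in> components (complement a b I)"
  then obtain x where x: "x \<in> C" using in_components_nonempty by blast
  have sub: "C \<subseteq> complement a b I" using C by (rule in_components_subset)
  define s where "s = positive_side a b I x"
  have "C \<subseteq> region_of a b I s"
    using connected_imp_same_side[OF in_components_connected[OF C] sub _ x] sub
    by (auto simp: region_of_def s_def)
  moreover have "region_of a b I s \<subseteq> C"
    by (rule components_maximal[OF C connected_region_of])
       (use x sub in \<open>auto simp: region_of_def s_def\<close>)
  moreover have "s \<in> patterns a b I UNIV" using x sub by (auto simp: patterns_def s_def)
  ultimately show "C \<in> region_of a b I ` patterns a b I UNIV" by blast
next
  fix C assume "C \<in> region_of a b I ` patterns a b I UNIV"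
  then obtain s where s: "s \<in> patterns a b I UNIV" "C = region_of a b I s" by blast
  show "C \<in> components (complement a b I)"
    unfolding in_components_maximal
  proof (intro conjI allI impI)
    show "C \<noteq> {}" using region_of_nonempty[OF s(1)] s(2) by simp
    then obtain x where x: "x \<in> C" by blast
    show "C \<subseteq> complement a b I" by (auto simp: s(2) region_of_def)
    show "connected C" unfolding s(2) by (rule connected_region_of)
    fix D assume D: "D \<noteq> {} \<and> C \<subseteq> D \<and> D \<subseteq> complement a b I \<and> connected D"
    then have "positive_side a b I y = positive_side a b I x" if "y \<in> D" for y
      using connected_imp_same_side[of D a b I y x] that x by blast
    then have "D \<subseteq> C" using D x by (auto simp: s(2) region_of_def)
    then show "D = C" using D by blast
  qed
qed

lemma inj_on_region_of: "inj_on (region_of a b I) (patterns a b I UNIV)"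
proof (rule inj_onI)
  fix s s' assume "s \<in> patterns a b I UNIV" "region_of a b I s = region_of a b I s'"
  then show "s = s'" using region_of_nonempty[of s a b I] by (auto simp: region_of_def)
qed

section \<open>Upper and lower bounds for the level\<close>

text \<open>Distance to a subspace scales linearly, so a ray at bounded distance from
  \<open>W\<close> puts \<open>v\<close> within a constant over \<open>s\<close> of \<open>W\<close>
  for every \<open>s > 0\<close>; letting \<open>s\<close> grow and using closedness of
  \<open>W\<close> gives membership.\<close>

lemma recession_direction_in_subspace:
  fixes W :: "'e::euclidean_space set"
  assumes W: "subspace W" and ray: "\<And>s. s \<ge> 0 \<Longrightarrow> infdist (x + s *\<^sub>R v) W \<le> r"
  shows "v \<in> W"
proof -
  have ne: "W \<noteq> {}" using subspace_0[OF W] by blast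
  have "infdist v W \<le> (r + norm x) / s" if s: "s > 0" for s
  proof -
    have "infdist (s *\<^sub>R v) W \<le> infdist (x + s *\<^sub>R v) W + dist (s *\<^sub>R v) (x + s *\<^sub>R v)"
      by (rule infdist_triangle)
    also have "\<dots> \<le> r + norm x" using ray[of s] s by (simp add: dist_norm)
    finally have le: "infdist (s *\<^sub>R v) W \<le> r + norm x" .
    obtain w where w: "w \<in> W" "infdist (s *\<^sub>R v) W = dist (s *\<^sub>R v) w"
      using infdist_attains_inf[OF closed_subspace[OF W] ne] by blast
    \<comment> \<open>The point of \<open>W\<close> nearest to \<open>s *\<^sub>R v\<close>, scaled
      back by \<open>1 / s\<close>, is the competitor for \<open>v\<close>.\<close>
    have "infdist v W \<le> dist v ((1 / s) *\<^sub>R w)"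
      using w(1) W by (intro infdist_le subspace_scale)
    also have "\<dots> = dist (s *\<^sub>R v) w / s"
    proof -
      have "v - (1 / s) *\<^sub>R w = (1 / s) *\<^sub>R (s *\<^sub>R v - w)"
        using s by (simp add: scaleR_diff_right)
      then show ?thesis using s by (simp add: dist_norm)
    qed
    also have "\<dots> \<le> (r + norm x) / s" using le w(2) s by (simp add: divide_right_mono)
    finally show ?thesis .
  qed
  moreover have "((\<lambda>s. (r + norm x) / s) \<longlongrightarrow> 0) at_top"
    by (intro tendsto_divide_0[OF tendsto_const] filterlim_at_top_imp_at_infinity filterlim_ident)
  ultimately have "infdist v W \<le> 0"
    by (intro tendsto_lowerbound[of _ 0 at_top]) (auto intro!: eventually_mono[OF eventually_gt_at_top[of 0]])
  then have "infdist v W = 0" using infdist_nonneg[of v W] by linarith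
  then show ?thesis using in_closed_iff_infdist_zero[OF closed_subspace[OF W] ne] by blast
qed

lemma bounded_differences_along_rtrancl:
  fixes X :: "(real^'n::finite) set"
  assumes "(i, j) \<in> D\<^sup>*" and "\<And>i j. (i, j) \<in> D \<Longrightarrow> \<exists>c. \<forall>x\<in>X. x$i - x$j \<le> c"
  shows "\<exists>c. \<forall>x\<in>X. x$i - x$j \<le> c"
  using assms(1)
proof (induction rule: rtrancl_induct)
  case base
  show ?case by (auto intro: exI[of _ 0])
next
  case (step k l)
  obtain c where c: "\<forall>x\<in>X. x$i - x$k \<le> c" using step.IH by blast
  obtain d where d: "\<forall>x\<in>X. x$k - x$l \<le> d" using assms(2) step.hyps(2) by blast
  have "x$i - x$l \<le> c + d" if "x \<in> X" for x
    using bspec[OF c that] bspec[OF d that] by linarith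
  then show ?case by blast
qed

text \<open>Replacing each coordinate by that of its class representative lands in the class space.
  The hypothesis, used for both orders of a pair, bounds the displacement in every
  coordinate.\<close>

lemma near_class_space:
  fixes X :: "(real^'n::finite) set" and \<phi> :: "'n \<Rightarrow> 'c"
  assumes "\<And>i j. \<phi> i = \<phi> j \<Longrightarrow> \<exists>c. \<forall>x\<in>X. x$i - x$j \<le> c"
  shows "\<exists>r>0. X \<subseteq> {x. infdist x (class_space \<phi>) \<le> r}"
proof -
  define rep where "rep i = inv \<phi> (\<phi> i)" for i
  have rep: "\<phi> (rep i) = \<phi> i" for i by (simp add: rep_def f_inv_into_f)
  obtain c where c: "\<And>i x. x \<in> X \<Longrightarrow> x$i - x$(rep i) \<le> c i"
    using assms[OF rep[symmetric]] by metis
  obtain d where d: "\<And>i x. x \<in> X \<Longrightarrow> x$(rep i) - x$i \<le> d i"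
    using assms[OF rep] by metis
  define r where "r = 1 + (\<Sum>i\<in>UNIV. \<bar>c i\<bar> + \<bar>d i\<bar>)"
  have "r > 0" unfolding r_def by (intro add_pos_nonneg sum_nonneg) auto
  moreover have "infdist x (class_space \<phi>) \<le> r" if x: "x \<in> X" for x
  proof -
    define w :: "real^'n" where "w = (\<chi> i. x$(rep i))"
    have w: "w \<in> class_space \<phi>" by (simp add: w_def class_space_def rep_def)
    have "dist x w \<le> (\<Sum>i\<in>UNIV. \<bar>(x - w)$i\<bar>)" unfolding dist_norm by (rule norm_le_l1_cart)
    also have "\<dots> \<le> (\<Sum>i\<in>UNIV. \<bar>c i\<bar> + \<bar>d i\<bar>)"
    proof (rule sum_mono)
      fix i
      show "\<bar>(x - w)$i\<bar> \<le> \<bar>c i\<bar> + \<bar>d i\<bar>"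
        using c[OF x, of i] d[OF x, of i] by (simp add: w_def abs_le_iff) linarith
    qed
    also have "\<dots> \<le> r" by (simp add: r_def)
    finally show ?thesis using infdist_le2[OF w] by blast
  qed
  ultimately show ?thesis by blast
qed

text \<open>The cone of monotone vectors is full-dimensional in the class space, so each vector of
  the latter is a difference of two vectors of the cone. This turns containment of the cone in a
  subspace into a dimension bound.\<close>

lemma class_space_subset_span_monotone:
  fixes \<phi> :: "'n::finite \<Rightarrow> nat"
  shows "class_space \<phi> \<subseteq> span {v::real^'n. \<forall>i j. \<phi> i \<le> \<phi> j \<longrightarrow> v$i \<le> v$j}"
    (is "_ \<subseteq> span ?C")
proof
  fix w :: "real^'n" assume w: "w \<in> class_space \<phi>"
  \<comment> \<open>\<open>u\<close> is deep enough inside the cone that \<open>u + w\<close> stays in it.\<close>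
  define N where "N = 2 * norm w"
  define u :: "real^'n" where "u = (\<chi> i. N * real (\<phi> i))"
  have "u \<in> ?C" by (auto simp: u_def N_def intro!: mult_left_mono)
  moreover have "u + w \<in> ?C"
  proof (intro CollectI allI impI)
    fix i j assume le: "\<phi> i \<le> \<phi> j"
    show "(u + w)$i \<le> (u + w)$j"
    proof (cases "\<phi> i = \<phi> j")
      case True
      then have "w$i = w$j" using w unfolding class_space_def by blast
      with True show ?thesis by (simp add: u_def)
    next
      case False
      with le have "real (\<phi> i) + 1 \<le> real (\<phi> j)" by linarith
      then have "N * (real (\<phi> i) + 1) \<le> N * real (\<phi> j)" by (intro mult_left_mono) (auto simp: N_def)
      moreover have "w$i - w$j \<le> N"
        using component_le_norm_cart[of w i] component_le_norm_cart[of w j] unfolding N_def by linarith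
      ultimately show ?thesis by (simp add: u_def algebra_simps)
    qed
  qed
  ultimately have "(u + w) - u \<in> span ?C" by (intro span_diff span_base)
  then show "w \<in> span ?C" by simp
qed

text \<open>Upper bound: \<open>X\<close> stays near the class space, whose dimension is the number
  of classes. Lower bound: a subspace near \<open>X\<close> contains all recession directions, hence
  the monotone cone and its span.\<close>

lemma level_eq:
  fixes X :: "(real^'n::finite) set" and \<phi> :: "'n \<Rightarrow> nat"
  assumes ne: "X \<noteq> {}"
    and bdd: "\<And>i j. \<phi> i = \<phi> j \<Longrightarrow> \<exists>c. \<forall>x\<in>X. x$i - x$j \<le> c"
    and rec: "\<And>x v s. \<lbrakk>x \<in> X; \<And>i j. \<phi> i \<le> \<phi> j \<Longrightarrow> v$i \<le> v$j; s \<ge> 0\<rbrakk> \<Longrightarrow> x + s *\<^sub>R v \<in> X"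
  shows "level X = card (range \<phi>)"
  unfolding level_def
proof (rule Least_equality)
  show "\<exists>W r. subspace W \<and> dim W = card (range \<phi>) \<and> 0 < r \<and> X \<subseteq> {x. infdist x W \<le> r}"
    using near_class_space[OF bdd] subspace_class_space[of \<phi>] dim_class_space[of \<phi>] by blast
next
  fix l assume "\<exists>W r. subspace W \<and> dim W = l \<and> 0 < r \<and> X \<subseteq> {x. infdist x W \<le> r}"
  then obtain W r where W: "subspace W" "dim W = l" "X \<subseteq> {x. infdist x W \<le> r}" by blast
  obtain x where x: "x \<in> X" using ne by blast
  have "{v::real^'n. \<forall>i j. \<phi> i \<le> \<phi> j \<longrightarrow> v$i \<le> v$j} \<subseteq> W"
  proof
    fix v :: "real^'n" assume v: "v \<in> {v. \<forall>i j. \<phi> i \<le> \<phi> j \<longrightarrow> v$i \<le> v$j}"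
    show "v \<in> W"
    proof (rule recession_direction_in_subspace[OF W(1), of x v r])
      fix s :: real assume "s \<ge> 0"
      then have "x + s *\<^sub>R v \<in> X" using rec[OF x, of v s] v by blast
      then show "infdist (x + s *\<^sub>R v) W \<le> r" using W(3) by blast
    qed
  qed
  then have "class_space \<phi> \<subseteq> W"
    using class_space_subset_span_monotone span_minimal[OF _ W(1)] by blast
  then show "card (range \<phi>) \<le> l" using dim_subset[of "class_space \<phi>" W] W(2) dim_class_space[of \<phi>] by simp
qed

section \<open>Deformations of type A\<close>

text \<open>The set determines its unordered pair of coordinates, so non-degeneracy, stated for
  arbitrary equations, carries over to the equation chosen for each hyperplane.\<close>

lemma hyp_eq_imp_indices:
  fixes i j k l :: "'n::finite"
  assumes eq: "hyp i j c = hyp k l d" and ne: "i \<noteq> j" "k \<noteq> l"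
  shows "(k = i \<and> l = j) \<or> (k = j \<and> l = i)"
proof -
  have *: "m \<in> {i, j}" if m: "m \<in> {k, l}" for m
  proof (rule ccontr)
    assume "m \<notin> {i, j}"
    then have out: "m \<noteq> i" "m \<noteq> j" by auto
    \<comment> \<open>Coordinate \<open>m\<close> is free on the first hyperplane but not on the
      second; \<open>s = 0\<close> and \<open>s = 1\<close> give a contradiction.\<close>
    have "axis i c + axis m s \<in> hyp i j c" for s :: real
      using out ne(1) by (auto simp: hyp_def axis_def)
    then have "axis i c + axis m s \<in> hyp k l d" for s :: real using eq by blast
    from this[of 0] this[of 1] show False
      using m ne(2) by (auto simp: hyp_def axis_def split: if_splits)
  qed
  from *[of k] *[of l] ne(2) show ?thesis by auto
qed

definition real_vec :: "('n \<Rightarrow> nat) \<Rightarrow> real^'n" where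
  "real_vec f = (\<chi> i. real (f i))"

lemma real_card_filter: "finite S \<Longrightarrow> real (card {x\<in>S. P x}) = (\<Sum>x\<in>S. if P x then 1 else 0)"
  by (simp add: sum.If_cases Int_def)

text \<open>One equation is fixed per hyperplane, which also orients it. The arrangement thus
  becomes a family indexed by its own members, and the general results apply with
  \<open>I = A\<close>.\<close>

locale type_A_deformation =
  fixes A :: "(real^'n::finite) set set"
    and p q :: "(real^'n) set \<Rightarrow> 'n" and c :: "(real^'n) set \<Rightarrow> real"
  assumes fin: "finite A"
    and pq: "H \<in> A \<Longrightarrow> p H \<noteq> q H"
    and hyp: "H \<in> A \<Longrightarrow> H = hyp (p H) (q H) (c H)"
    and nondeg: "i \<noteq> j \<Longrightarrow> \<exists>c. hyp i j c \<in> A"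
begin

definition normal :: "(real^'n) set \<Rightarrow> real^'n" where
  "normal H = axis (p H) 1 - axis (q H) 1"

lemma inner_normal: "normal H \<bullet> x = x $ p H - x $ q H"
  by (simp add: normal_def inner_diff_left inner_axis')

lemma mem_iff: "H \<in> A \<Longrightarrow> x \<in> H \<longleftrightarrow> normal H \<bullet> x = c H"
  using hyp[of H] unfolding inner_normal hyp_def by blast

lemma Inter_eq_flat: "B \<subseteq> A \<Longrightarrow> \<Inter>B = flat normal c B"
  using mem_iff by (auto simp: flat_def)

lemma complement_eq: "UNIV - \<Union>A = complement normal c A"
  using mem_iff by (auto simp: complement_def)

lemma UNIV_notin: "UNIV \<notin> A"
proof
  assume A: "UNIV \<in> A"
  have "axis (p UNIV) (c UNIV + 1) \<in> (UNIV :: (real^'n) set)" by simp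
  then have "normal UNIV \<bullet> axis (p UNIV) (c UNIV + 1) = c UNIV" using mem_iff[OF A] by blast
  then show False using pq[OF A] by (simp add: inner_normal axis_def)
qed

text \<open>The direction space of a flat is the space of vectors constant on the classes of
  coordinates that the equations tie together. Its dimension is the number of classes, and a
  parallel box point takes one of \<open>t\<close> values on each class.\<close>

lemma card_nat_maps_parallel:
  assumes ne: "flat normal c B \<noteq> {}"
  shows "card {f\<in>nat_maps t. \<forall>H\<in>B. normal H \<bullet> real_vec f = 0} = t ^ nat (aff_dim (flat normal c B))"
proof -
  define V where "V = {v. \<forall>H\<in>B. normal H \<bullet> v = 0}"
  \<comment> \<open>Each class is labelled by itself: the coordinates that agree with
    \<open>i\<close> on all of \<open>V\<close>.\<close>
  define \<phi> where "\<phi> i = {j. \<forall>v\<in>V. v$i = v$j}" for i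
  have \<phi>: "\<phi> i = \<phi> j \<longleftrightarrow> (\<forall>v\<in>V. v$i = v$j)" for i j
  proof
    assume "\<phi> i = \<phi> j"
    moreover have "j \<in> \<phi> j" by (simp add: \<phi>_def)
    ultimately have "j \<in> \<phi> i" by blast
    then show "\<forall>v\<in>V. v$i = v$j" by (simp add: \<phi>_def)
  next
    assume "\<forall>v\<in>V. v$i = v$j"
    then have "(\<forall>v\<in>V. v$i = v$k) \<longleftrightarrow> (\<forall>v\<in>V. v$j = v$k)" for k by fastforce
    then show "\<phi> i = \<phi> j" unfolding \<phi>_def by blast
  qed
  have V: "V = class_space \<phi>"
  proof
    show "V \<subseteq> class_space \<phi>" using \<phi> unfolding class_space_def by blast
    show "class_space \<phi> \<subseteq> V"
    proof
      fix v assume v: "v \<in> class_space \<phi>"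
      have "normal H \<bullet> v = 0" if "H \<in> B" for H
      proof -
        have "\<phi> (p H) = \<phi> (q H)" unfolding \<phi> using that by (auto simp: V_def inner_normal)
        then have "v $ p H = v $ q H" using v unfolding class_space_def by blast
        then show ?thesis by (simp add: inner_normal)
      qed
      then show "v \<in> V" by (simp add: V_def)
    qed
  qed
  obtain x where x: "x \<in> flat normal c B" using ne by blast
  have "flat normal c B = (+) x ` V"
  proof (intro equalityI subsetI)
    fix y assume "y \<in> flat normal c B"
    then have "y - x \<in> V" using x by (auto simp: flat_def V_def inner_diff_right)
    then show "y \<in> (+) x ` V" by (intro image_eqI[of _ _ "y - x"]) auto
  next
    fix y assume "y \<in> (+) x ` V"
    then show "y \<in> flat normal c B" using x by (auto simp: flat_def V_def inner_add_right)
  qed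
  then have "aff_dim (flat normal c B) = int (card (range \<phi>))"
    using aff_dim_translation_eq[of x V] aff_dim_subspace[OF subspace_class_space[of \<phi>]]
      dim_class_space[of \<phi>] V by simp
  moreover have "(\<forall>H\<in>B. normal H \<bullet> real_vec f = 0) \<longleftrightarrow> (\<forall>i j. \<phi> i = \<phi> j \<longrightarrow> f i = f j)" for f
  proof -
    have "(\<forall>H\<in>B. normal H \<bullet> real_vec f = 0) \<longleftrightarrow> real_vec f \<in> V" by (simp add: V_def)
    also have "\<dots> \<longleftrightarrow> (\<forall>i j. \<phi> i = \<phi> j \<longrightarrow> f i = f j)"
      unfolding V class_space_def real_vec_def by simp
    finally show ?thesis .
  qed
  ultimately show ?thesis by (simp add: card_nat_maps_constant_on_classes)
qed

text \<open>Each hyperplane bounds one coordinate difference from above on the region.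
  Non-degeneracy relates any two coordinates, so the reflexive-transitive closure of this relation
  is a total preorder. Recession vectors are those monotone along it, and equivalent coordinates
  stay at bounded distance.\<close>

lemma total_preorder_of_pattern:
  assumes s: "s \<in> patterns normal c A UNIV"
  obtains \<phi> :: "'n \<Rightarrow> nat" where
    "level (region_of normal c A s) = card (range \<phi>)"
    "\<And>f. recedes normal A s (real_vec f) \<longleftrightarrow> (\<forall>i j. \<phi> i \<le> \<phi> j \<longrightarrow> f i \<le> f j)"
proof -
  define X where "X = region_of normal c A s"
  \<comment> \<open>\<open>(i, j) \<in> D\<close> means that some inequality of the region bounds
    \<open>x$i - x$j\<close> from above; on the positive side the roles of \<open>p H\<close> and
    \<open>q H\<close> are exchanged.\<close>
  define D where "D = {(i, j). \<exists>H\<in>A. if H \<in> s then i = q H \<and> j = p H else i = p H \<and> j = q H}"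
  \<comment> \<open>Counting predecessors ranks the classes. The ranks need not be consecutive; only
    their order and their number matter.\<close>
  define \<phi> where "\<phi> i = card {k. (k, i) \<in> D\<^sup>*}" for i
  have sub: "s \<subseteq> A" using s by (auto simp: patterns_def positive_side_def)
  have X: "X = {x. \<forall>H\<in>A. if H \<in> s then normal H \<bullet> x > c H else normal H \<bullet> x < c H}"
    unfolding X_def by (rule region_of_eq[OF sub])
  have total: "(i, j) \<in> D \<or> (j, i) \<in> D" if "i \<noteq> j" for i j
  proof -
    obtain d where d: "hyp i j d \<in> A" using nondeg[OF \<open>i \<noteq> j\<close>] by blast
    define H where "H = hyp i j d"
    have H: "H \<in> A" using d by (simp add: H_def)
    from hyp_eq_imp_indices[OF _ that pq[OF H]] hyp[OF H]
    have "p H = i \<and> q H = j \<or> p H = j \<and> q H = i" unfolding H_def by blast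
    with H show ?thesis unfolding D_def by auto
  qed
  have \<phi>: "\<phi> i \<le> \<phi> j \<longleftrightarrow> (i, j) \<in> D\<^sup>*" for i j
  proof
    assume "(i, j) \<in> D\<^sup>*"
    then show "\<phi> i \<le> \<phi> j" unfolding \<phi>_def by (intro card_mono) (auto intro: rtrancl_trans)
  next
    assume le: "\<phi> i \<le> \<phi> j"
    show "(i, j) \<in> D\<^sup>*"
    proof (rule ccontr)
      assume no: "(i, j) \<notin> D\<^sup>*"
      then have "i \<noteq> j" by auto
      with total[of i j] no have "(j, i) \<in> D\<^sup>*" by auto
      then have "{k. (k, j) \<in> D\<^sup>*} \<subset> {k. (k, i) \<in> D\<^sup>*}"
        using no by (auto intro: rtrancl_trans)
      then have "\<phi> j < \<phi> i" unfolding \<phi>_def by (intro psubset_card_mono) auto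
      then show False using le by simp
    qed
  qed
  have rec: "recedes normal A s v \<longleftrightarrow> (\<forall>i j. \<phi> i \<le> \<phi> j \<longrightarrow> v$i \<le> v$j)" for v
  proof -
    have "recedes normal A s v \<longleftrightarrow> (\<forall>i j. (i, j) \<in> D \<longrightarrow> v$i \<le> v$j)"
    proof
      assume r: "recedes normal A s v"
      show "\<forall>i j. (i, j) \<in> D \<longrightarrow> v$i \<le> v$j"
      proof (intro allI impI)
        fix i j assume "(i, j) \<in> D"
        then obtain H where H: "H \<in> A" "if H \<in> s then i = q H \<and> j = p H else i = p H \<and> j = q H"
          by (auto simp: D_def)
        have "if H \<in> s then normal H \<bullet> v \<ge> 0 else normal H \<bullet> v \<le> 0"
          using r H(1) unfolding recedes_def by blast
        then show "v$i \<le> v$j" using H(2) by (auto simp: inner_normal split: if_splits)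
      qed
    next
      assume D: "\<forall>i j. (i, j) \<in> D \<longrightarrow> v$i \<le> v$j"
      show "recedes normal A s v"
        unfolding recedes_def
      proof
        fix H assume H: "H \<in> A"
        then have "H \<in> s \<Longrightarrow> (q H, p H) \<in> D" "H \<notin> s \<Longrightarrow> (p H, q H) \<in> D" by (auto simp: D_def)
        with D show "if H \<in> s then normal H \<bullet> v \<ge> 0 else normal H \<bullet> v \<le> 0"
          by (simp add: inner_normal)
      qed
    qed
    also have "\<dots> \<longleftrightarrow> (\<forall>i j. (i, j) \<in> D\<^sup>* \<longrightarrow> v$i \<le> v$j)"
    proof (intro iffI allI impI)
      fix i j assume D: "\<forall>i j. (i, j) \<in> D \<longrightarrow> v$i \<le> v$j" and "(i, j) \<in> D\<^sup>*"
      from this(2) show "v$i \<le> v$j"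
      proof (induction rule: rtrancl_induct)
        case (step k l)
        then show ?case using D by (meson order_trans)
      qed simp
    qed blast
    finally show ?thesis by (simp only: \<phi>)
  qed
  have "level X = card (range \<phi>)"
  proof (rule level_eq)
    show "X \<noteq> {}" unfolding X_def using s by (rule region_of_nonempty)
    show "\<exists>d. \<forall>x\<in>X. x$i - x$j \<le> d" if "\<phi> i = \<phi> j" for i j
    proof (rule bounded_differences_along_rtrancl)
      show "(i, j) \<in> D\<^sup>*" using \<phi> that by (metis order_refl)
      fix k l assume "(k, l) \<in> D"
      then obtain H where H: "H \<in> A" "if H \<in> s then k = q H \<and> l = p H else k = p H \<and> l = q H"
        by (auto simp: D_def)
      \<comment> \<open>The bound is \<open>- c H\<close> on the positive side and
        \<open>c H\<close> on the negative side; the absolute value covers both.\<close>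
      have "x$k - x$l \<le> \<bar>c H\<bar>" if "x \<in> X" for x
      proof -
        have "if H \<in> s then normal H \<bullet> x > c H else normal H \<bullet> x < c H"
          using that H(1) unfolding X by blast
        with H(2) show ?thesis by (auto simp: inner_normal split: if_splits)
      qed
      then show "\<exists>d. \<forall>x\<in>X. x$k - x$l \<le> d" by blast
    qed
    fix x v :: "real^'n" and r :: real
    assume x: "x \<in> X" and v: "\<And>i j. \<phi> i \<le> \<phi> j \<Longrightarrow> v$i \<le> v$j" and r: "r \<ge> 0"
    have "recedes normal A s v" using rec v by blast
    show "x + r *\<^sub>R v \<in> X"
      unfolding X
    proof (intro CollectI ballI)
      fix H assume H: "H \<in> A"
      have 1: "if H \<in> s then normal H \<bullet> x > c H else normal H \<bullet> x < c H"
        using x H unfolding X by blast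
      have 2: "if H \<in> s then normal H \<bullet> v \<ge> 0 else normal H \<bullet> v \<le> 0"
        using \<open>recedes normal A s v\<close> H unfolding recedes_def by blast
      show "if H \<in> s then normal H \<bullet> (x + r *\<^sub>R v) > c H else normal H \<bullet> (x + r *\<^sub>R v) < c H"
      proof (cases "H \<in> s")
        case True
        then have "r * (normal H \<bullet> v) \<ge> 0" using 2 r by simp
        with True 1 show ?thesis by (simp add: inner_add_right)
      next
        case False
        then have "r * (normal H \<bullet> v) \<le> 0" using 2 r by (simp add: mult_nonneg_nonpos)
        with False 1 show ?thesis by (simp add: inner_add_right)
      qed
    qed
  qed
  moreover have "recedes normal A s (real_vec f) \<longleftrightarrow> (\<forall>i j. \<phi> i \<le> \<phi> j \<longrightarrow> f i \<le> f j)" for f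
    unfolding rec real_vec_def by simp
  ultimately show ?thesis using that unfolding X_def by blast
qed

text \<open>At negative integers the signs separate from the counts, and both sides count the same
  incidences between patterns and box vectors. Infinitely many such values determine the
  polynomial.\<close>

lemma char_poly_minus_nat:
  assumes t: "t \<ge> 1"
  shows "char_poly A (- real t) =
    (\<Sum>k = 0..CARD('n). (- 1) ^ (CARD('n) - k) * real (num_regions_level A k) * ((- real t) gchoose k))"
proof -
  define n where "n = CARD('n)"
  define S where "S = patterns normal c A UNIV"
  define F :: "('n \<Rightarrow> nat) set" where "F = nat_maps t"
  define par where "par B f \<longleftrightarrow> (\<forall>H\<in>B. normal H \<bullet> real_vec f = 0)" for B f
  \<comment> \<open>The Whitney term at -1; the remaining factor \<open>t\<close> to the power of
    the dimension is replaced by a count of parallel box vectors.\<close>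
  define w where "w B = (- 1) ^ card B * dim_sign (flat normal c B)" for B
  have finS: "finite S" unfolding S_def using fin by (rule finite_patterns)
  have finF: "finite F" unfolding F_def by (rule finite_nat_maps)
  have "char_poly A (- real t) = (\<Sum>B\<in>Pow A. w B * real (card {f\<in>F. par B f}))"
    unfolding whitney[OF fin UNIV_notin]
  proof (rule sum.mono_neutral_cong_left)
    show "\<forall>B\<in>Pow A - {B\<in>Pow A. \<Inter>B \<noteq> {}}. w B * real (card {f\<in>F. par B f}) = 0"
      using Inter_eq_flat by (auto simp: w_def dim_sign_def)
    fix B assume "B \<in> {B\<in>Pow A. \<Inter>B \<noteq> {}}"
    then have B: "B \<subseteq> A" "flat normal c B \<noteq> {}" using Inter_eq_flat by auto
    have "real (card {f\<in>F. par B f}) = real t ^ nat (aff_dim (flat normal c B))"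
      unfolding F_def par_def card_nat_maps_parallel[OF B(2)] by simp
    then show "(- 1) ^ card B * (- real t) ^ nat (aff_dim (\<Inter>B)) = w B * real (card {f\<in>F. par B f})"
      using B power_minus[of "real t"] by (simp add: w_def dim_sign_def Inter_eq_flat)
  qed (use fin in auto)
  also have "\<dots> = (\<Sum>B\<in>Pow A. \<Sum>f\<in>F. if par B f then w B else 0)"
    unfolding real_card_filter[OF finF] sum_distrib_left by (intro sum.cong refl) simp
  also have "\<dots> = (\<Sum>f\<in>F. \<Sum>B\<in>Pow A. if par B f then w B else 0)" by (rule sum.swap)
  also have "\<dots> = (\<Sum>f\<in>F. (- 1) ^ n * real (card {s\<in>S. recedes normal A s (real_vec f)}))"
  proof (intro sum.cong refl)
    fix f
    define J where "J = {H\<in>A. normal H \<bullet> real_vec f = 0}"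
    have "(\<Sum>B\<in>Pow A. if par B f then w B else 0) = (\<Sum>B\<in>{B\<in>Pow A. par B f}. w B)"
      using fin by (intro sum.inter_filter[symmetric]) simp
    \<comment> \<open>The subfamilies parallel to \<open>f\<close> form a full power set, so
      Zaslavsky's theorem for the subarrangement \<open>J\<close> evaluates the sum.\<close>
    also have "{B\<in>Pow A. par B f} = Pow J" by (auto simp: J_def par_def)
    also have "(\<Sum>B\<in>Pow J. w B) = (- 1) ^ nat (aff_dim (UNIV :: (real^'n) set)) * real (card (patterns normal c J UNIV))"
      unfolding w_def using fin by (subst zaslavsky) (auto simp: J_def)
    also have "\<dots> = (- 1) ^ n * real (card {s\<in>S. recedes normal A s (real_vec f)})"
      unfolding J_def S_def card_patterns_parallel[OF fin] by (simp add: n_def)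
    finally show "(\<Sum>B\<in>Pow A. if par B f then w B else 0) = \<dots>" .
  qed
  also have "\<dots> = (- 1) ^ n * (\<Sum>f\<in>F. \<Sum>s\<in>S. if recedes normal A s (real_vec f) then 1 else 0)"
    unfolding real_card_filter[OF finS] sum_distrib_left ..
  also have "\<dots> = (- 1) ^ n * (\<Sum>s\<in>S. real (card {f\<in>F. recedes normal A s (real_vec f)}))"
    unfolding real_card_filter[OF finF] by (subst sum.swap) simp
  also have "(\<Sum>s\<in>S. real (card {f\<in>F. recedes normal A s (real_vec f)})) =
      (\<Sum>s\<in>S. (- 1) ^ level (region_of normal c A s) * (- real t gchoose level (region_of normal c A s)))"
  proof (intro sum.cong refl)
    fix s assume "s \<in> S"
    then obtain \<phi> :: "'n \<Rightarrow> nat" where \<phi>: "level (region_of normal c A s) = card (range \<phi>)"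
      "\<And>f. recedes normal A s (real_vec f) \<longleftrightarrow> (\<forall>i j. \<phi> i \<le> \<phi> j \<longrightarrow> f i \<le> f j)"
      using total_preorder_of_pattern unfolding S_def by blast
    define k where "k = card (range \<phi>)"
    have "real (card {f\<in>F. recedes normal A s (real_vec f)}) = real ((t + k - 1) choose k)"
      unfolding \<phi>(2) F_def card_nat_maps_monotone k_def ..
    \<comment> \<open>Upper negation of the binomial coefficient; \<open>t \<ge> 1\<close> makes the
      subtraction in \<open>t + k - 1\<close> exact.\<close>
    also have "\<dots> = (- 1) ^ k * (- real t gchoose k)"
      using t gbinomial_negated_upper[of "- real t" k]
      by (simp add: binomial_gbinomial of_nat_diff add.commute)
    finally show "real (card {f\<in>F. recedes normal A s (real_vec f)}) =
      (- 1) ^ level (region_of normal c A s) * (- real t gchoose level (region_of normal c A s))"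
      unfolding \<phi>(1) k_def .
  qed
  also have "\<dots> = (\<Sum>R\<in>regions A. (- 1) ^ level R * (- real t gchoose level R))"
    unfolding regions_def complement_eq components_complement S_def
    by (subst sum.reindex[OF inj_on_region_of]) simp
  also have "\<dots> = (\<Sum>k\<in>{0..n}. \<Sum>R\<in>{R\<in>regions A. level R = k}. (- 1) ^ level R * (- real t gchoose level R))"
  proof (rule sum.group[symmetric])
    have reg: "regions A = region_of normal c A ` S"
      unfolding regions_def complement_eq components_complement S_def ..
    show "finite (regions A)" unfolding reg using finS by simp
    \<comment> \<open>There are at most \<open>n\<close> classes, so grouping by levels from 0 to
      \<open>n\<close> loses no region.\<close>
    show "level ` regions A \<subseteq> {0..n}"
    proof
      fix k assume "k \<in> level ` regions A"
      then obtain s where s: "s \<in> patterns normal c A UNIV" "k = level (region_of normal c A s)"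
        unfolding reg S_def by blast
      from total_preorder_of_pattern[OF s(1)] obtain \<phi> :: "'n \<Rightarrow> nat" where "k = card (range \<phi>)"
        unfolding s(2) by metis
      then show "k \<in> {0..n}" by (simp add: n_def card_image_le)
    qed
  qed simp
  also have "\<dots> = (\<Sum>k = 0..n. (- 1) ^ k * (real (num_regions_level A k) * (- real t gchoose k)))"
    by (intro sum.cong refl) (simp add: num_regions_level_def)
  also have "(- 1) ^ n * \<dots> = (\<Sum>k = 0..n. (- 1) ^ (n - k) * real (num_regions_level A k) * ((- real t) gchoose k))"
    unfolding sum_distrib_left
  proof (intro sum.cong refl)
    fix k assume "k \<in> {0..n}"
    \<comment> \<open>Since \<open>k \<le> n\<close>, the numbers \<open>n - k\<close> and
      \<open>n + k\<close> have the same parity.\<close>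
    then have sign: "(- 1 :: real) ^ (n - k) = (- 1) ^ n * (- 1) ^ k"
      by (auto simp: minus_one_power_iff)
    show "(- 1) ^ n * ((- 1) ^ k * (real (num_regions_level A k) * (- real t gchoose k))) =
      (- 1) ^ (n - k) * real (num_regions_level A k) * ((- real t) gchoose k)"
      unfolding sign by (simp only: mult.assoc)
  qed
  finally show ?thesis unfolding n_def .
qed

end

text \<open>Both sides are polynomial functions of \<open>t\<close> that agree at all negative
  integers, so they agree everywhere.\<close>

theorem theorem1p1:
  fixes A :: "(real^'n::finite) set set"
  assumes fin: "finite A"
    and deform: "\<forall>H\<in>A. \<exists>i j c. i \<noteq> j \<and> H = hyp i j c"
    and nondeg: "\<forall>i j. i \<noteq> j \<longrightarrow> (\<exists>c. hyp i j c \<in> A)"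
  shows "char_poly A t =
    (\<Sum>k = 0..CARD('n). (-1) ^ (CARD('n) - k) * real (num_regions_level A k) * (t gchoose k))"
proof -
  obtain p q c where "\<forall>H\<in>A. p H \<noteq> q H \<and> H = hyp (p H) (q H) (c H)"
    using deform by metis
  then interpret type_A_deformation A p q c
    using fin nondeg by unfold_locales auto
  define a where "a k = (- 1) ^ (CARD('n) - k) * real (num_regions_level A k)" for k
  define P where "P = (\<Sum>X\<in>intersection_poset A.
      monom (mobius (intersection_poset A) (\<lambda>X Y. Y \<subseteq> X) UNIV X) (nat (aff_dim X)))"
  \<comment> \<open>Each \<open>gchoose\<close> is written as a falling factorial over
    \<open>fact k\<close>, a polynomial in its upper argument.\<close>
  define Q where "Q = (\<Sum>k = 0..CARD('n). smult (a k / fact k) (\<Prod>i = 0..<k. [:- real i, 1:]))"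
  have P: "poly P x = char_poly A x" for x
    by (simp add: P_def char_poly_def poly_sum poly_monom)
  have Q: "poly Q x = (\<Sum>k = 0..CARD('n). a k * (x gchoose k))" for x
    unfolding Q_def poly_sum by (simp add: poly_prod gbinomial_prod_rev)
  have "P - Q = 0"
  proof (rule ccontr)
    assume "P - Q \<noteq> 0"
    then have "finite {x. poly (P - Q) x = 0}" by (rule poly_roots_finite)
    moreover have "(\<lambda>m. - real m) ` {1..} \<subseteq> {x. poly (P - Q) x = 0}"
      using char_poly_minus_nat by (auto simp: P Q a_def)
    ultimately have "finite ((\<lambda>m. - real m) ` {1::nat..})" by (rule rev_finite_subset)
    then show False by (subst (asm) finite_image_iff) (auto simp: inj_on_def infinite_Ici)
  qed
  then have "poly P t = poly Q t" by simp
  then show ?thesis unfolding P Q a_def .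
qed

end
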